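(* Let $\boldsymbol\ell$ and $\boldsymbol m$ be the lexicographically least and lexicographically greatest faux-bonacci binary $\omega$-words, defined as below. Then $\boldsymbol m=1\varphi^2(\boldsymbol m)$ and $\boldsymbol\ell=0\varphi^2(\boldsymbol\ell)$.
   Context: $\varphi$ is the morphism $0\mapsto 01$, $1\mapsto 0$ on $\{0,1\}$. For non-empty $X$, $X^-$ is $X$ with last letter erased; a $4^-$-power is $XXXX^-$ with $X$ non-empty; a binary word is faux-bonacci (fb) if it has no factor $11$ and no factor that is a $4^-$-power. Order words lexicographically with $0<1$. For $n\ge0$, let $\ell_n$ (resp. $m_n$) be the lexicographically least (resp. greatest) word of length $n$ that is a prefix of some fb $\omega$-word. Each $\ell_n$ is a prefix of $\ell_{n+1}$ and each $m_n$ is a prefix of $m_{n+1}$; set $\boldsymbol\ell=\lim_n\ell_n$ and $\boldsymbol m=\lim_n m_n$ (these are the lexicographically least and greatest fb $\omega$-words). *)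

theory Defs
  imports "HOL-Library.Stream" "HOL-Library.List_Lexorder"
begin

text \<open>
  The binary alphabet is \<^typ>\<open>bool\<close>, with \<^term>\<open>False\<close> for the letter 0 and \<^term>\<open>True\<close> for
  the letter 1, so that the library order \<^prop>\<open>False < True\<close> is \<open>0 < 1\<close>. Finite words are lists,
  ordered lexicographically by \<^theory>\<open>HOL-Library.List_Lexorder\<close>; \<open>\<omega>\<close>-words are streams.
\<close>

definition factor :: "'a list \<Rightarrow> 'a stream \<Rightarrow> bool" where
  "factor u w \<longleftrightarrow> (\<exists>i. stake (length u) (sdrop i w) = u)"

text \<open>A single letter is a possible base: then the last block is empty and the word is a cube.\<close>

definition four_minus_power :: "'a list \<Rightarrow> bool" where
  "four_minus_power u \<longleftrightarrow> (\<exists>x. x \<noteq> [] \<and> u = x @ x @ x @ butlast x)"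

definition faux_bonacci :: "bool stream \<Rightarrow> bool" where
  "faux_bonacci w \<longleftrightarrow>
     \<not> factor [True, True] w \<and> (\<forall>u. factor u w \<longrightarrow> \<not> four_minus_power u)"

fun phi_letter :: "bool \<Rightarrow> bool list" where
  "phi_letter False = [False, True]"
| "phi_letter True = [False]"

text \<open>The morphism on \<open>\<omega>\<close>-words; \<^const>\<open>flat\<close> is concatenation here since no letter is erased.\<close>

definition phi :: "bool stream \<Rightarrow> bool stream" where
  "phi w = flat (smap phi_letter w)"

definition least_fb_prefix :: "nat \<Rightarrow> bool list" where
  "least_fb_prefix n = Min {stake n w | w. faux_bonacci w}"

definition greatest_fb_prefix :: "nat \<Rightarrow> bool list" where
  "greatest_fb_prefix n = Max {stake n w | w. faux_bonacci w}"

text \<open>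
  The limit of a sequence of finite words, each a prefix of the next and with unbounded lengths:
  the \<open>\<omega>\<close>-word of which all of them are prefixes.
\<close>

definition word_lim :: "(nat \<Rightarrow> 'a list) \<Rightarrow> 'a stream" where
  "word_lim u = (THE w. \<forall>n. stake (length (u n)) w = u n)"

definition least_fb :: "bool stream" where
  "least_fb = word_lim least_fb_prefix"

definition greatest_fb :: "bool stream" where
  "greatest_fb = word_lim greatest_fb_prefix"

end

theory Submission
  imports Defs
begin

text \<open>
  A word without \<open>11\<close> that starts with 0 factors uniquely into the blocks \<open>01\<close> and \<open>0\<close>, so it is
  \<open>\<phi>(w)\<close> for a unique \<open>w\<close>, and \<open>4\<^sup>-\<close>-powers transfer between \<open>w\<close> and \<open>\<phi>(w)\<close>, getting shorter in the
  passage to \<open>w\<close>. Hence \<open>\<phi>\<close> preserves and reflects being fb, and every fb word is \<open>\<phi>(w)\<close> or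
  \<open>1\<phi>(w)\<close> with \<open>w\<close> fb. Let \<open>m\<close> solve \<open>m = 1\<phi>\<^sup>2(m)\<close>. A shortest \<open>4\<^sup>-\<close>-power \<open>xxxx\<^sup>-\<close> in \<open>m\<close> cannot lie in
  \<open>\<phi>\<^sup>2(m)\<close>, and as a prefix it would make the prefix \<open>10101\<close> of \<open>m\<close> recur in \<open>\<phi>\<^sup>2(m)\<close>, which would
  force \<open>000\<close> in \<open>\<phi>(m)\<close> and \<open>11\<close> in \<open>m\<close>; so \<open>m\<close> is fb. As \<open>\<phi>\<close> reverses the lexicographic order,
  induction on the length of prefixes shows that \<open>m = 1\<phi>(\<phi>(m))\<close> is greatest and \<open>\<phi>(m)\<close> is least.
\<close>

section \<open>Factors of infinite words\<close>

lemma factor_iff: "factor u w \<longleftrightarrow> (\<exists>p v. w = p @- u @- v)"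
proof
  assume "factor u w"
  then obtain i where "stake (length u) (sdrop i w) = u"
    by (auto simp: factor_def)
  then have "w = stake i w @- u @- sdrop (length u) (sdrop i w)"
    by (metis stake_sdrop)
  then show "\<exists>p v. w = p @- u @- v" by blast
next
  assume "\<exists>p v. w = p @- u @- v"
  then obtain p v where "w = p @- u @- v" by blast
  then have "stake (length u) (sdrop (length p) w) = u"
    by (simp add: sdrop_shift stake_shift)
  then show "factor u w" unfolding factor_def by blast
qed

lemma shift_butlast_last: "u \<noteq> [] \<Longrightarrow> butlast u @- last u ## v = u @- v"
  by (induction u) auto

lemma factor_mid: "factor u (p @- u @- v)"
  by (auto simp: factor_iff)

lemma factor_shift: "factor u w \<Longrightarrow> factor u (p @- w)"
  by (metis factor_iff shift_append)

lemma factor_append: "factor (a @ u @ b) w \<Longrightarrow> factor u w"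
  by (metis factor_iff shift_append)

lemma factor_SCons: "factor u w \<Longrightarrow> factor u (a ## w)"
  using factor_shift[of u w "[a]"] by simp

section \<open>The morphism and its desubstitution\<close>

definition phi_word :: "bool list \<Rightarrow> bool list" where
  "phi_word u = concat (map phi_letter u)"

lemma phi_word_simps [simp]:
  "phi_word [] = []"
  "phi_word (False # u) = False # True # phi_word u"
  "phi_word (True # u) = False # phi_word u"
  "phi_word (u @ v) = phi_word u @ phi_word v"
  by (simp_all add: phi_word_def)

lemma phi_SCons [simp]:
  "phi (False ## w) = False ## True ## phi w"
  "phi (True ## w) = False ## phi w"
  by (subst phi_def, subst stream.map, subst flat_Stream, simp_all add: phi_def)+

lemma phi_shift [simp]: "phi (u @- w) = phi_word u @- phi w"
proof (induction u)
  case (Cons a u)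
  then show ?case by (cases a) simp_all
qed simp

lemma shd_phi [simp]: "shd (phi w) = False"
  by (cases w; cases "shd w") auto

lemma phi_neq_True_SCons [simp]: "phi w \<noteq> True ## v" "True ## v \<noteq> phi w"
  by (metis shd_phi stream.sel(1))+

lemma phi_starts_01: "phi w = False ## True ## v \<Longrightarrow> \<exists>w'. w = False ## w' \<and> v = phi w'"
  by (cases w; cases "shd w") auto

lemma phi_starts_00: "phi w = False ## False ## v \<Longrightarrow> \<exists>w'. w = True ## w' \<and> False ## v = phi w'"
  by (cases w; cases "shd w") auto

lemma hd_phi_word: "u \<noteq> [] \<Longrightarrow> \<exists>v. phi_word u = False # v"
  by (cases u; cases "hd u") auto

text \<open>Every block begins with 0 and contains no other 0, so the letter after a 0, if any,
  tells 01 from 0.\<close>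

lemma phi_word_inj: "phi_word u = phi_word v \<Longrightarrow> u = v"
proof (induction u arbitrary: v)
  case Nil
  then show ?case using hd_phi_word[of v] by fastforce
next
  case (Cons a u)
  then obtain b v' where v: "v = b # v'" using hd_phi_word[of "a # u"]
    by (cases v) auto
  then show ?case using Cons hd_phi_word[of u] hd_phi_word[of v']
    by (cases a; cases b; cases "u = []"; cases "v' = []") auto
qed

text \<open>In an image, 0 occurs only as the first letter of a block, so a cut in front of a 0
  never splits a block.\<close>

lemma phi_desubst:
  assumes "phi w = u @- v" "shd v = False"
  obtains u' w' where "w = u' @- w'" "u = phi_word u'" "v = phi w'"
proof -
  have "\<exists>u' w'. w = u' @- w' \<and> u = phi_word u' \<and> v = phi w'"
    using assms
  proof (induction "length u" arbitrary: u w rule: less_induct)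
    case less
    show ?case
    proof (cases u)
      case Nil
      then show ?thesis using less.prems by (intro exI[of _ "[]"]) auto
    next
      case u: (Cons a u1)
      obtain b w1 where w: "w = b ## w1" by (metis stream.exhaust)
      show ?thesis
      proof (cases b)
        case True
        then have "phi w1 = u1 @- v" and a: "\<not> a" using less.prems u w by auto
        then obtain u' w' where "w1 = u' @- w'" "u1 = phi_word u'" "v = phi w'"
          using less.hyps[of u1 w1] less.prems u by auto
        then show ?thesis using a u w True by (intro exI[of _ "True # u'"] exI[of _ w']) auto
      next
        case False
        then have "True ## phi w1 = u1 @- v" and a: "\<not> a" using less.prems u w by auto
        then obtain u2 where u1: "u1 = True # u2" and "phi w1 = u2 @- v"
          using less.prems by (cases u1) (auto dest: arg_cong[of _ _ shd])
        then obtain u' w' where "w1 = u' @- w'" "u2 = phi_word u'" "v = phi w'"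
          using less.hyps[of u2 w1] less.prems u by auto
        then show ?thesis using a u u1 w False by (intro exI[of _ "False # u'"] exI[of _ w']) auto
      qed
    qed
  qed
  then show ?thesis using that by blast
qed

lemma phi_desubst_word:
  assumes "phi w = phi_word u @- v" "shd v = False"
  obtains w' where "w = u @- w'" "v = phi w'"
  using phi_desubst[OF assms] phi_word_inj by metis

lemma phi_no_11: "\<not> factor [True, True] (phi w)"
proof
  assume "factor [True, True] (phi w)"
  then obtain p v where "phi w = p @- True ## True ## v"
    by (auto simp: factor_iff)
  then show False
  proof (induction "length p" arbitrary: p w rule: less_induct)
    case less
    obtain b w1 where w: "w = b ## w1" by (metis stream.exhaust)
    obtain a p1 where p: "p = a # p1" using less.prems by (cases p) auto
    show False
    proof (cases b)
      case True
      then show False using less.hyps[of p1 w1] less.prems w p by simp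
    next
      case False
      then obtain c p2 where "p1 = c # p2" using less.prems w p by (cases p1) auto
      then show False using False less.hyps[of p2 w1] less.prems w p by simp
    qed
  qed
qed

text \<open>A 0 followed by 0 is a whole block, the image of 1.\<close>

lemma factor_000_phi:
  assumes "factor [False, False, False] (phi w)"
  shows "factor [True, True] w"
proof -
  obtain p v where "phi w = p @- False ## False ## False ## v"
    using assms by (auto simp: factor_iff)
  then obtain q w' where "w = q @- w'" "phi w' = False ## False ## False ## v"
    using phi_desubst[of w p "False ## False ## False ## v"] by (metis stream.sel(1))
  moreover from this obtain w2 where "w' = True ## w2" "phi w2 = False ## False ## v"
    by (metis phi_starts_00)
  moreover from this obtain w3 where "w2 = True ## w3"
    by (metis phi_starts_00)
  ultimately show ?thesis using factor_mid[of "[True, True]" q w3] by simp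
qed

text \<open>The letter before the first 1 must be 0, which completes three blocks 01.\<close>

lemma factor_10101_phi:
  assumes "factor [True, False, True, False, True] (phi w)"
  shows "factor [False, False, False] w"
proof -
  let ?s = "\<lambda>v. True ## False ## True ## False ## True ## v"
  obtain p v where pv: "phi w = p @- ?s v"
    using assms by (auto simp: factor_iff)
  then have "p \<noteq> []" by auto
  then obtain p' a where p: "p = p' @ [a]" by (metis rev_exhaust)
  have "\<not> a"
    using pv p phi_no_11[of w] factor_mid[of "[True, True]" p' "stl (?s v)"] by auto
  then have "phi w = p' @- False ## ?s v" using pv p by simp
  then obtain q w' where w: "w = q @- w'" "phi w' = False ## ?s v"
    using phi_desubst[of w p' "False ## ?s v"] by (metis stream.sel(1))
  then obtain w3 where "w' = False ## False ## False ## w3"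
    by (metis phi_starts_01)
  then show ?thesis using w factor_mid[of "[False, False, False]" q w3] by simp
qed

section \<open>Transfer of powers along \<open>phi\<close>\<close>

abbreviation pow4m :: "'a list \<Rightarrow> 'a list" where
  "pow4m x \<equiv> x @ x @ x @ butlast x"

lemma faux_bonacci_iff:
  "faux_bonacci w \<longleftrightarrow> \<not> factor [True, True] w \<and> (\<forall>x. x \<noteq> [] \<longrightarrow> \<not> factor (pow4m x) w)"
  unfolding faux_bonacci_def four_minus_power_def by blast

text \<open>This makes desubstitution strictly shorten a base, as only 0 has a longer image.\<close>

lemma square_no_11_has_False:
  assumes "\<not> factor [True, True] w" "factor (y @ y) w" "y \<noteq> []"
  shows "False \<in> set y"
proof (rule ccontr)
  assume F: "False \<notin> set y"
  then obtain z where y: "y = True # z" using assms(3) by (cases y) auto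
  then have "\<exists>c. y @ y = [True, True] @ c" using F by (cases z) auto
  then show False using assms factor_append[of "[]" "[True, True]"] by (metis append_Nil)
qed

lemma length_phi_word: "False \<in> set u \<Longrightarrow> length u < length (phi_word u)"
proof -
  have le: "length u \<le> length (phi_word u)" for u
  proof (induction u)
    case (Cons a u)
    then show ?case by (cases a) auto
  qed simp
  show "False \<in> set u \<Longrightarrow> length u < length (phi_word u)"
  proof (induction u)
    case (Cons a u)
    then show ?case using le[of u] by (cases a) auto
  qed simp
qed

text \<open>A base starting with 0 puts every copy at a block boundary, so three copies of its
  preimage \<open>y\<close> can be read off. Only the truncated fourth copy needs care, since what
  follows it is arbitrary.\<close>

lemma pow4m_phi_False:
  assumes w: "\<not> factor [True, True] w"
    and f: "factor (pow4m (False # z)) (phi w)"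
  shows "\<exists>y. y \<noteq> [] \<and> factor (pow4m y) w \<and> length y < length (False # z)"
proof (cases "z = []")
  case True
  then show ?thesis using f w factor_000_phi by fastforce
next
  case False
  define x where "x = False # z"
  have bl: "shd (butlast x @- v) = False" and x: "shd (x @- v) = False" for v
    using False by (auto simp: x_def)
  obtain p v where "phi w = p @- x @- x @- x @- butlast x @- v"
    using f by (auto simp: factor_iff x_def)
  then obtain q w0 where w0: "w = q @- w0" "phi w0 = x @- x @- x @- butlast x @- v"
    using phi_desubst[of w p "x @- x @- x @- butlast x @- v"] x by metis
  then obtain y w1 where w1: "w0 = y @- w1" "x = phi_word y" "phi w1 = x @- x @- butlast x @- v"
    using phi_desubst[of w0 x "x @- x @- butlast x @- v"] x by metis
  then obtain w2 where w2: "w1 = y @- w2" "phi w2 = x @- butlast x @- v"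
    using phi_desubst_word[of w1 y "x @- butlast x @- v"] x by metis
  then obtain w3 where w3: "w2 = y @- w3" "phi w3 = butlast x @- v"
    using phi_desubst_word[of w2 y "butlast x @- v"] bl w1(2) by metis
  have wy: "w = q @- y @- y @- y @- w3" using w0 w1 w2 w3 by simp
  have "y \<noteq> []" using w1(2) x_def by auto
  then obtain y' a where y: "y = y' @ [a]" by (metis rev_exhaust)
  have "\<exists>w4. w3 = y' @- w4"
  proof (cases a)
    \<comment> \<open>Truncating the final 01 leaves the 0 that marks the boundary after
      \<open>phi_word y'\<close>.\<close>
    case a: False
    then have "phi w3 = phi_word y' @- False ## v" using w3(2) w1(2) y by (simp add: butlast_append)
    then show ?thesis using phi_desubst_word[of w3 y' "False ## v"] by (metis stream.sel(1))
  next
    \<comment> \<open>Truncation removes the whole last block, so no 0 is at hand to mark the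
      boundary. Absence of 11 makes a non-empty \<open>y'\<close> end in 0, and the block 01 of that
      letter is recognised from its own letters.\<close>
    case a: True
    show ?thesis
    proof (cases "y' = []")
      case False
      then obtain y2 b where y': "y' = y2 @ [b]" by (metis rev_exhaust)
      have "\<not> b"
      proof
        assume b
        then have "w = (q @ y2) @- [True, True] @- y @- y @- w3" using wy y y' a by simp
        then show False using w factor_mid by metis
      qed
      then have "phi w3 = phi_word y2 @- False ## True ## v"
        using w3(2) w1(2) y y' a by (simp add: butlast_append)
      then obtain w4 where "w3 = y2 @- w4" "phi w4 = False ## True ## v"
        using phi_desubst_word[of w3 y2 "False ## True ## v"] by (metis stream.sel(1))
      moreover from this obtain w5 where "w4 = False ## w5" by (metis phi_starts_01)
      ultimately show ?thesis using y' \<open>\<not> b\<close> by auto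
    qed auto
  qed
  then obtain w4 where "w = q @- pow4m y @- w4" using wy y by auto
  then have fy: "factor (pow4m y) w" using factor_mid by metis
  then have "factor (y @ y) w" using factor_append[of "[]" "y @ y" "y @ butlast y"] by simp
  then have "length y < length x"
    using square_no_11_has_False[OF w] \<open>y \<noteq> []\<close> length_phi_word w1(2) by metis
  then show ?thesis using fy \<open>y \<noteq> []\<close> x_def by blast
qed

text \<open>Images start with 0 and avoid 11, so a base starting with 1 ends in 0 and its power is
  preceded by 0. Conjugating the base by one letter reduces to \<open>pow4m_phi_False\<close> at
  equal length.\<close>

lemma pow4m_phi:
  assumes w: "\<not> factor [True, True] w"
    and x: "x \<noteq> []" "factor (pow4m x) (phi w)"
  shows "\<exists>y. y \<noteq> [] \<and> factor (pow4m y) w \<and> length y < length x"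
proof (cases "hd x")
  case False
  then show ?thesis using pow4m_phi_False[OF w, of "tl x"] x by (cases x) auto
next
  case True
  then obtain x1 where x1: "x = True # x1" using x by (cases x) auto
  have "x1 \<noteq> []"
    using x x1 phi_no_11[of w] factor_append[of "[]" "[True, True]" "[True]"] by auto
  then obtain z c where z: "x1 = z @ [c]" by (metis rev_exhaust)
  have "\<not> c"
  proof
    assume c
    then have "pow4m x = (True # z) @ [True, True] @ (x1 @ x @ butlast x)" using x1 z by simp
    then show False using x phi_no_11[of w] factor_append by metis
  qed
  with x1 z have xz: "x = True # z @ [False]" by simp
  obtain p v where pv: "phi w = p @- pow4m x @- v" using x by (auto simp: factor_iff)
  then have "p \<noteq> []" using xz by auto
  then obtain p' a where p: "p = p' @ [a]" by (metis rev_exhaust)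
  have "\<not> a"
  proof
    assume a
    then have "phi w = p' @- [True, True] @- stl (pow4m x @- v)" using pv p xz by simp
    then show False using phi_no_11[of w] factor_mid by metis
  qed
  \<comment> \<open>the power shifted one letter to the left starts with 0\<close>
  then have "phi w = p' @- (False # True # z) @- (False # True # z) @- (False # True # z) @-
      (False # True # z) @- v"
    using pv p xz by (simp add: butlast_append)
  then have "phi w = p' @- pow4m (False # True # z) @- last (False # True # z) ## v"
    using shift_butlast_last[of "False # True # z"] by simp
  then have "factor (pow4m (False # True # z)) (phi w)" using factor_mid by metis
  then show ?thesis using pow4m_phi_False[OF w, of "True # z"] xz by auto
qed

text \<open>If \<open>x\<close> ends in 0, truncating after applying the morphism keeps one 0 more
  than truncating before; the next block supplies it.\<close>

lemma pow4m_phi_converse: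
  assumes "factor (pow4m x) w" "x \<noteq> []"
  shows "factor (pow4m (phi_word x)) (phi w)"
proof -
  obtain p v where w: "w = p @- pow4m x @- v" using assms by (auto simp: factor_iff)
  obtain x' a where x: "x = x' @ [a]" using assms by (metis rev_exhaust)
  obtain t where t: "phi v = False ## t" by (metis shd_phi stream.collapse)
  have "\<exists>s. phi_word (butlast x) @- phi v = butlast (phi_word x) @- s"
    using t x by (cases a) (auto simp: butlast_append)
  then obtain s where "phi_word (butlast x) @- phi v = butlast (phi_word x) @- s" by blast
  then have "phi w = phi_word p @- pow4m (phi_word x) @- s" using w by simp
  then show ?thesis using factor_mid by metis
qed

lemma faux_bonacci_phi:
  assumes "faux_bonacci w"
  shows "faux_bonacci (phi w)"
  using assms pow4m_phi phi_no_11 unfolding faux_bonacci_iff by blast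

lemma faux_bonacci_phi_reflect:
  assumes "faux_bonacci (phi w)"
  shows "faux_bonacci w"
proof -
  have "\<not> factor [True, True] w"
  proof
    assume "factor [True, True] w"
    then obtain p v where "w = p @- True ## True ## v" by (auto simp: factor_iff)
    \<comment> \<open>The next block always starts with 0, so the image 00 of 11 extends to 000, the
      power with base 0.\<close>
    moreover obtain t where "phi v = False ## t" by (metis shd_phi stream.collapse)
    ultimately have "phi w = phi_word p @- pow4m [False] @- t" by simp
    then show False using assms factor_mid unfolding faux_bonacci_iff by (metis list.discI)
  qed
  moreover have "\<not> factor (pow4m x) w" if "x \<noteq> []" for x
    using assms that pow4m_phi_converse hd_phi_word unfolding faux_bonacci_iff
    by (metis list.discI)
  ultimately show ?thesis unfolding faux_bonacci_iff by blast
qed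

lemma faux_bonacci_shift: "faux_bonacci (p @- w) \<Longrightarrow> faux_bonacci w"
  using factor_shift unfolding faux_bonacci_iff by metis

section \<open>Decoding of faux-bonacci words\<close>

text \<open>The first letter is presumed to be 0 and never inspected; the second one decides whether
  the block 01 or the block 0 is removed.\<close>

primcorec phi_inv :: "bool stream \<Rightarrow> bool stream" where
  "shd (phi_inv w) = (\<not> shd (stl w))"
| "stl (phi_inv w) = phi_inv (if shd (stl w) then stl (stl w) else stl w)"

lemma stream_eqI_stake: "(\<And>n. stake n u = stake n v) \<Longrightarrow> u = v"
  by (metis lessI stake_nth smap_alt stream.map_id id_apply)

lemma phi_phi_inv:
  assumes "\<not> factor [True, True] w" "\<not> shd w"
  shows "phi (phi_inv w) = w"
proof (rule stream_eqI_stake)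
  fix n
  show "stake n (phi (phi_inv w)) = stake n w"
    using assms
  proof (induction n arbitrary: w rule: less_induct)
    case (less n)
    obtain b t where w: "w = False ## b ## t" using less.prems(2) by (metis stream.collapse)
    have t: "\<not> factor [True, True] (b ## t)"
      using less.prems(1) w factor_SCons by metis
    show ?case
    proof (cases b)
      case True
      have "\<not> shd t"
        using t True factor_mid[of "[True, True]" "[]" "stl t"] by (cases t) auto
      moreover have "\<not> factor [True, True] t" using t factor_SCons by metis
      moreover have "phi_inv w = False ## phi_inv t"
        using w True by (subst phi_inv.code) simp
      ultimately show ?thesis
        using less.IH w True by (cases n; cases "n - 1") auto
    next
      case False
      moreover have "phi_inv w = True ## phi_inv (b ## t)"
        using w False by (subst phi_inv.code) simp
      ultimately show ?thesis using less.IH[of "n - 1" "b ## t"] t w by (cases n) auto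
    qed
  qed
qed

lemma faux_bonacci_cases:
  assumes "faux_bonacci w"
  obtains v where "faux_bonacci v" "w = phi v" | v where "faux_bonacci v" "w = True ## phi v"
proof -
  have *: "\<exists>v. faux_bonacci v \<and> u = phi v" if "faux_bonacci u" "\<not> shd u" for u
    using that phi_phi_inv[of u] faux_bonacci_phi_reflect unfolding faux_bonacci_iff by metis
  show ?thesis
  proof (cases "shd w")
    case False
    then show ?thesis using *[of w] assms that by blast
  next
    case True
    then obtain u where w: "w = True ## u" by (metis stream.collapse)
    have "\<not> shd u"
    proof
      assume "shd u"
      then have "w = [] @- [True, True] @- stl u" using w by (cases u) simp
      then show False using assms factor_mid unfolding faux_bonacci_iff by metis
    qed
    moreover have "faux_bonacci u" using assms w faux_bonacci_shift[of "[True]"] by simp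
    ultimately show ?thesis using * w that by metis
  qed
qed

section \<open>Order reversal\<close>

lemma stake_le_mono:
  fixes u v :: "bool stream"
  shows "stake n u \<le> stake n v \<Longrightarrow> k \<le> n \<Longrightarrow> stake k u \<le> stake k v"
proof (induction k arbitrary: u v n)
  case (Suc k)
  then show ?case by (cases n; cases u; cases v) auto
qed simp

text \<open>A first difference 0 against 1 becomes 01 against 0 followed by the 0 of the next block.
  Images are never shorter than their words, so the length \<open>n\<close> can be kept.\<close>

lemma phi_antimono:
  "stake n u \<le> stake n v \<Longrightarrow> stake n (phi v) \<le> stake n (phi u)"
proof (induction n arbitrary: u v rule: less_induct)
  case (less n)
  show ?case
  proof (cases n)
    case n: (Suc k)
    obtain a u' b v' where uv: "u = a ## u'" "v = b ## v'" by (metis stream.exhaust)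
    have le: "stake k u' \<le> stake k v'" if "a = b" using less.prems n uv that by auto
    have ab: "a \<le> b" using less.prems n uv by auto
    show ?thesis
    proof (cases b)
      case False
      then have "\<not> a" using ab by auto
      then show ?thesis
        using False le uv n less.IH stake_le_mono[of k u' v' "k - 1"] by (cases k) auto
    next
      case True
      obtain t where "phi v' = False ## t" by (metis shd_phi stream.collapse)
      then show ?thesis
        using True le uv n less.IH[of k u' v'] by (cases a; cases k) auto
    qed
  qed simp
qed

section \<open>The fixed point\<close>

text \<open>
  Reading a letter off the queue appends its image under \<open>\<phi>\<^sup>2\<close>, so that the output is the
  initial queue followed by the image of the output itself.
\<close>

primcorec phi2_queue :: "bool list \<Rightarrow> bool stream" where
  "shd (phi2_queue q) = hd q"
| "stl (phi2_queue q) = phi2_queue (tl q @ phi_word (phi_word [hd q]))"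

text \<open>The queue changes with each letter, so the induction ranges over all non-empty queues;
  the fixed point is the instance \<open>[True]\<close>.\<close>

lemma phi2_queue_eq: "q \<noteq> [] \<Longrightarrow> phi2_queue q = q @- phi (phi (phi2_queue q))"
proof (rule stream_eqI_stake)
  fix n
  show "q \<noteq> [] \<Longrightarrow> stake n (phi2_queue q) = stake n (q @- phi (phi (phi2_queue q)))"
  proof (induction n arbitrary: q)
    case (Suc n)
    let ?q = "tl q @ phi_word (phi_word [hd q])"
    have "?q \<noteq> []" using hd_phi_word by (metis Nil_is_append_conv list.discI)
    then have IH: "stake n (phi2_queue ?q) = stake n (?q @- phi (phi (phi2_queue ?q)))"
      by (rule Suc.IH)
    have "phi2_queue q = [hd q] @- phi2_queue ?q" by (subst phi2_queue.code) simp
    then have "phi (phi (phi2_queue q)) = phi_word (phi_word [hd q]) @- phi (phi (phi2_queue ?q))"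
      by (metis phi_shift)
    then have "q @- phi (phi (phi2_queue q)) = hd q ## ?q @- phi (phi (phi2_queue ?q))"
      using Suc.prems by (cases q) auto
    then show ?case using IH by simp
  qed simp
qed

lemma fixed_point_faux_bonacci:
  assumes m: "m = True ## phi (phi m)"
  shows "faux_bonacci m"
proof -
  have no11: "\<not> factor [True, True] m"
  proof
    assume "factor [True, True] m"
    then obtain p v where pv: "m = p @- True ## True ## v" by (auto simp: factor_iff)
    show False
    proof (cases p)
      case Nil
      then show False using pv m by (metis phi_neq_True_SCons(1) shift.simps(1) stream.inject)
    next
      case (Cons a p')
      then have "phi (phi m) = p' @- [True, True] @- v" using pv m
        by (metis shift.simps stream.inject)
      then show False using phi_no_11 factor_mid by metis
    qed
  qed
  have no10101: "\<not> factor [True, False, True, False, True] (phi (phi m))"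
    using no11 factor_000_phi factor_10101_phi by blast
  \<comment> \<open>The two letters 10 already determine 1 followed by 01 and 010, the images of 1
    and 0 under the squared morphism.\<close>
  obtain t where "m = True ## False ## t"
    using m by (metis shd_phi stream.collapse)
  then have "m = True ## phi (phi (True ## False ## t))" using m by simp
  then have m5: "stake 5 m = [True, False, True, False, True]"
    by (simp add: eval_nat_numeral)
  have "\<not> factor (pow4m x) m" if "x \<noteq> []" for x
    using that
  proof (induction "length x" arbitrary: x rule: less_induct)
    case less
    show ?case
    proof
      assume "factor (pow4m x) m"
      then obtain p v where pv: "m = p @- pow4m x @- v" by (auto simp: factor_iff)
      show False
      proof (cases p)
        \<comment> \<open>Away from the start the power lies in \<open>phi (phi m)\<close>, and two
          desubstitutions yield a strictly shorter base in \<open>m\<close>.\<close>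
        case (Cons a p')
        then have "phi (phi m) = p' @- pow4m x @- v" using pv m
          by (metis shift.simps(2) stream.inject)
        then have "factor (pow4m x) (phi (phi m))" using factor_mid by metis
        then obtain y where "y \<noteq> []" "factor (pow4m y) (phi m)" "length y < length x"
          using pow4m_phi[OF phi_no_11] less.prems by metis
        moreover from this obtain z where "z \<noteq> []" "factor (pow4m z) m" "length z < length y"
          using pow4m_phi[OF no11] by metis
        ultimately show False using less.hyps by (metis less_trans)
      next
        case Nil
        obtain a x' where x: "x = a # x'" using less.prems by (cases x) auto
        have "x' \<noteq> []"
        proof
          assume "x' = []"
          then have "m = a ## a ## a ## v" using x pv Nil by simp
          then show False using m by (metis phi_neq_True_SCons(1) stream.inject)
        qed
        then have len: "length (x @ x @ butlast x) \<ge> 5"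
          using x by (cases x') auto
        \<comment> \<open>Deleting the first copy of \<open>x\<close> leaves a word agreeing with
          \<open>m\<close> on the length of \<open>x @ x @ butlast x\<close>, at least five letters,
          so 10101 recurs.\<close>
        let ?t = "(x @ x @ butlast x) @- v"
        have "m = (x @ x @ butlast x) @- last x ## butlast x @- v"
          using pv Nil less.prems by (simp add: shift_butlast_last)
        then have "stake 5 ?t = stake 5 m" using len by (simp add: stake_shift)
        then have "?t = [True, False, True, False, True] @- sdrop 5 ?t"
          using m5 by (metis stake_sdrop)
        moreover have "phi (phi m) = x' @- ?t" 
          using pv Nil x m by (metis shift.simps(2) append_Cons shift_append stream.inject append_Nil)
        ultimately show False using no10101 factor_mid by metis
      qed
    qed
  qed
  then show ?thesis using no11 unfolding faux_bonacci_iff by blast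
qed

section \<open>Extremality\<close>

lemma word_lim_eq:
  assumes "\<And>n. u n = stake n w"
  shows "word_lim u = w"
  unfolding word_lim_def assms by (rule the_equality) (auto intro: stream_eqI_stake)

lemma finite_stakes: "finite {stake n w | w. P (w :: bool stream)}"
  by (rule finite_subset[OF _ finite_lists_length_eq[of UNIV n]]) auto

text \<open>The bounds feed each other: the upper bound at length \<open>n\<close> gives the lower
  one at \<open>n\<close> by order reversal, and this gives the upper one at \<open>Suc n\<close>,
  the leading 1 of \<open>m\<close> adding a letter.\<close>

lemma fixed_point_extremal:
  assumes m: "m = True ## phi (phi m)"
  shows "faux_bonacci w \<Longrightarrow> stake n w \<le> stake n m"
    and "faux_bonacci w \<Longrightarrow> stake n (phi m) \<le> stake n w"
proof -
  have least: "stake n (phi m) \<le> stake n w"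
    if "faux_bonacci w" and A: "\<And>v. faux_bonacci v \<Longrightarrow> stake n v \<le> stake n m" for n w
    using that(1)
  proof (cases rule: faux_bonacci_cases)
    case (1 v)
    then show ?thesis using phi_antimono A by simp
  next
    case (2 v)
    then show ?thesis by (cases n) auto
  qed
  have greatest: "faux_bonacci w \<Longrightarrow> stake n w \<le> stake n m" for n w
  proof (induction n arbitrary: w)
    case (Suc n)
    from Suc.prems show ?case
    proof (cases rule: faux_bonacci_cases)
      case (1 v)
      then show ?thesis by (subst m) simp
    next
      case (2 v)
      then show ?thesis using phi_antimono least[OF 2(1) Suc.IH] by (subst m) simp
    qed
  qed simp
  show "faux_bonacci w \<Longrightarrow> stake n w \<le> stake n m" by (rule greatest)
  show "faux_bonacci w \<Longrightarrow> stake n (phi m) \<le> stake n w" by (rule least[OF _ greatest])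
qed

theorem theorem8:
  shows "greatest_fb = True ## (phi ^^ 2) greatest_fb \<and>
         least_fb = False ## (phi ^^ 2) least_fb"
proof -
  define m where "m = phi2_queue [True]"
  have m: "m = True ## phi (phi m)"
    using phi2_queue_eq[of "[True]"] by (simp add: m_def)
  have fb: "faux_bonacci m" "faux_bonacci (phi m)"
    using fixed_point_faux_bonacci[OF m] faux_bonacci_phi by auto
  have "greatest_fb_prefix n = stake n m" for n
    unfolding greatest_fb_prefix_def
    by (rule Max_eqI) (use finite_stakes fb fixed_point_extremal[OF m] in auto)
  then have greatest: "greatest_fb = m"
    unfolding greatest_fb_def by (rule word_lim_eq)
  have "least_fb_prefix n = stake n (phi m)" for n
    unfolding least_fb_prefix_def
    by (rule Min_eqI) (use finite_stakes fb fixed_point_extremal[OF m] in auto)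
  then have least: "least_fb = phi m"
    unfolding least_fb_def by (rule word_lim_eq)
  \<comment> \<open>Applying \<open>phi\<close> to the equation for \<open>m\<close> turns its
    leading 1 into 0.\<close>
  have "phi m = False ## phi (phi (phi m))"
    by (subst m) simp
  then show ?thesis
    using m by (simp add: greatest least eval_nat_numeral)
qed

end
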